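(* For $n\ge3$, the posets $\mathcal{FL}yn_n^\bullet$ and $\mathcal{SF}_n$ are not isomorphic.
   Context: $\mathcal{SF}_n$ is the poset of rooted spanning forests on vertex set $[n]$ (forests of rooted trees whose vertex set is $[n]$), with $F\lessdot F'$ iff $F'$ is obtained from $F$ by joining the roots of two of its trees by an edge and declaring one of these two roots to be the root of the new tree; its minimum is the forest of $n$ isolated rooted vertices. Trees: a bicolored binary forest on $[n]$ is a forest of rooted planar binary trees (left child $L(v)$, right child $R(v)$) with leaves bijectively labeled by $[n]$ and internal vertices colored in $\{0,1\}$. $\nu(v)$ is the smallest leaf label below $v$; normalized means $\nu(v)=\nu(L(v))$ for all internal $v$; $v$ is Lyndon if $L(v)$ is a leaf or $\nu(R(L(v)))>\nu(R(v))$. A normalized tree is a pointed Lyndon tree if every internal $v$ with internal left child satisfies $\mathrm{color}(L(v))\ge\mathrm{color}(v)$ and, when both colors are $1$, $v$ is Lyndon. To $u$-merge two pointed Lyndon trees $T_1,T_2$ (min leaf of $T_1$ smaller), create a new vertex $r$ of color $u$ with left child the root of $T_1$ and right child the root of $T_2$; while the result is not a pointed Lyndon tree, replace the subtree $r(x(X_L,X_R),Y)$ by $x(r(X_L,Y),X_R)$, colors kept. $\mathcal{FL}yn_n^\bullet$ is the set of forests on $[n]$ whose components are pointed Lyndon trees, with $F\lessdot F'$ iff $F'$ arises from $F$ by $u$-merging exactly two trees, $u\in\{0,1\}$. *)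

theory Defs
  imports Main "HOL-Library.While_Combinator"
begin

section \<open>Rooted spanning forests\<close>

definition adjacency :: "nat set set \<Rightarrow> (nat \<times> nat) set" where
  "adjacency E = {(a, b). {a, b} \<in> E}"

definition is_cycle :: "nat set set \<Rightarrow> nat list \<Rightarrow> bool" where
  "is_cycle E vs \<longleftrightarrow> 3 \<le> length vs \<and> distinct vs \<and>
     (\<forall>i < length vs. {vs ! i, vs ! (Suc i mod length vs)} \<in> E)"

text \<open>A rooted spanning forest on \<open>{1..n}\<close> is a pair \<open>(E, \<rho>)\<close>: the edge set \<open>E\<close> of an acyclic
  simple graph on the vertex set \<open>{1..n}\<close>, and a set \<open>\<rho>\<close> of roots containing exactly one vertex of
  each connected component.\<close>

type_synonym rooted_forest = "nat set set \<times> nat set"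

definition SF :: "nat \<Rightarrow> rooted_forest set" where
  "SF n = {(E, \<rho>).
     E \<subseteq> {{a, b} | a b. a \<in> {1..n} \<and> b \<in> {1..n} \<and> a \<noteq> b} \<and>
     (\<nexists>vs. is_cycle E vs) \<and>
     \<rho> \<subseteq> {1..n} \<and>
     (\<forall>v \<in> {1..n}. \<exists>!r. r \<in> \<rho> \<and> (v, r) \<in> (adjacency E)\<^sup>*)}"

definition SF_cover :: "nat \<Rightarrow> rooted_forest rel" where
  "SF_cover n = {(F, F'). F \<in> SF n \<and> F' \<in> SF n \<and>
     (\<exists>E \<rho> r s. F = (E, \<rho>) \<and> r \<in> \<rho> \<and> s \<in> \<rho> \<and> r \<noteq> s \<and>
        F' = (insert {r, s} E, \<rho> - {s}))}"

definition SF_le :: "nat \<Rightarrow> rooted_forest rel" where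
  "SF_le n = {(F, F'). F \<in> SF n \<and> F' \<in> SF n \<and> (F, F') \<in> (SF_cover n)\<^sup>*}"


section \<open>Forests of pointed Lyndon trees\<close>

text \<open>A vertex of a tree is identified with the subtree hanging from it.\<close>

datatype bctree =
  Leaf (label: nat)
| Node (color: nat) (left: bctree) (right: bctree)

fun leaves :: "bctree \<Rightarrow> nat list" where
  "leaves (Leaf i) = [i]"
| "leaves (Node c l r) = leaves l @ leaves r"

fun internals :: "bctree \<Rightarrow> bctree set" where
  "internals (Leaf i) = {}"
| "internals (Node c l r) = insert (Node c l r) (internals l \<union> internals r)"

definition \<nu> :: "bctree \<Rightarrow> nat" where
  "\<nu> v = Min (set (leaves v))"

definition bicolored :: "bctree \<Rightarrow> bool" where
  "bicolored T \<longleftrightarrow> distinct (leaves T) \<and> (\<forall>v \<in> internals T. color v \<in> {0, 1})"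

definition normalized :: "bctree \<Rightarrow> bool" where
  "normalized T \<longleftrightarrow> (\<forall>v \<in> internals T. \<nu> v = \<nu> (left v))"

definition lyndon :: "bctree \<Rightarrow> bool" where
  "lyndon v \<longleftrightarrow> is_Leaf (left v) \<or> \<nu> (right (left v)) > \<nu> (right v)"

definition pointed_lyndon :: "bctree \<Rightarrow> bool" where
  "pointed_lyndon T \<longleftrightarrow> bicolored T \<and> normalized T \<and>
     (\<forall>v \<in> internals T. \<not> is_Leaf (left v) \<longrightarrow>
        color (left v) \<ge> color v \<and>
        (color (left v) = 1 \<and> color v = 1 \<longrightarrow> lyndon v))"

text \<open>During merging, the new vertex \<open>r\<close> moves down the leftmost branch. The state \<open>(p, X)\<close> records
  the current left child \<open>X\<close> of \<open>r\<close> and the list \<open>p\<close> of the (color, right child) pairs of the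
  ancestors of \<open>r\<close>, innermost first; the color \<open>u\<close> and the right child \<open>Y\<close> of \<open>r\<close> never change.\<close>

fun current_tree :: "nat \<Rightarrow> bctree \<Rightarrow> (nat \<times> bctree) list \<times> bctree \<Rightarrow> bctree" where
  "current_tree u Y (p, X) = foldl (\<lambda>S (c, B). Node c S B) (Node u X Y) p"

text \<open>One replacement of \<open>r(x(X\<^sub>L, X\<^sub>R), Y)\<close> by \<open>x(r(X\<^sub>L, Y), X\<^sub>R)\<close>. The value when the
  left child of \<open>r\<close> is a leaf is irrelevant: for pointed Lyndon trees, the loop stops there at
  the latest.\<close>

fun slide :: "(nat \<times> bctree) list \<times> bctree \<Rightarrow> (nat \<times> bctree) list \<times> bctree" where
  "slide (p, Node c X\<^sub>L X\<^sub>R) = ((c, X\<^sub>R) # p, X\<^sub>L)"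
| "slide (p, Leaf i) = (p, Leaf i)"

definition merge :: "nat \<Rightarrow> bctree \<Rightarrow> bctree \<Rightarrow> bctree" where
  "merge u T\<^sub>1 T\<^sub>2 = current_tree u T\<^sub>2
     (while (\<lambda>s. \<not> pointed_lyndon (current_tree u T\<^sub>2 s)) slide ([], T\<^sub>1))"

definition FLyn :: "nat \<Rightarrow> bctree set set" where
  "FLyn n = {F. (\<forall>T \<in> F. pointed_lyndon T) \<and>
     pairwise (\<lambda>S T. disjnt (set (leaves S)) (set (leaves T))) F \<and>
     (\<Union>T \<in> F. set (leaves T)) = {1..n}}"

definition FLyn_cover :: "nat \<Rightarrow> bctree set rel" where
  "FLyn_cover n = {(F, F'). F \<in> FLyn n \<and> F' \<in> FLyn n \<and>
     (\<exists>u T\<^sub>1 T\<^sub>2. u \<in> {0, 1} \<and> T\<^sub>1 \<in> F \<and> T\<^sub>2 \<in> F \<and> \<nu> T\<^sub>1 < \<nu> T\<^sub>2 \<and>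
        F' = insert (merge u T\<^sub>1 T\<^sub>2) (F - {T\<^sub>1, T\<^sub>2}))}"

definition FLyn_le :: "nat \<Rightarrow> bctree set rel" where
  "FLyn_le n = {(F, F'). F \<in> FLyn n \<and> F' \<in> FLyn n \<and> (F, F') \<in> (FLyn_cover n)\<^sup>*}"

end

theory Submission imports Defs
begin

text \<open>In \<open>SF n\<close>, if \<open>Y\<close> arises from \<open>W\<close> by hanging the root \<open>s\<close> on the root \<open>r\<close> and \<open>Y\<close> has
  another root \<open>t\<close>, then \<open>t\<close> can be hung on \<open>r\<close> before or after \<open>s\<close>. So every non-maximal \<open>Y\<close> above
  some \<open>X\<close> has an upper bound in common with an element above \<open>X\<close> that is incomparable to \<open>Y\<close>. In
  \<open>FLyn n\<close> this fails for \<open>X = {1, 2, T}\<close> and \<open>Y = {1, 0(2, T)}\<close> with \<open>T\<close> a tree on \<open>{3..n}\<close>: the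
  left child of the root is a leaf in every tree above \<open>Y\<close>, but an internal vertex in every tree
  obtained from \<open>X\<close> by first merging \<open>1\<close> with \<open>2\<close> or with \<open>T\<close>.\<close>

section \<open>Joining roots of spanning forests\<close>

lemma sym_adjacency: "sym (adjacency E)"
  by (auto simp: sym_def adjacency_def insert_commute)

lemma adjacency_insert: "adjacency (insert {r, t} E) = insert (r, t) (insert (t, r) (adjacency E))"
  by (auto simp: adjacency_def doubleton_eq_iff)

lemma rtrancl_adjacency_sym: "(a, b) \<in> (adjacency E)\<^sup>* \<Longrightarrow> (b, a) \<in> (adjacency E)\<^sup>*"
  by (meson sym_adjacency sym_rtrancl symD)

text \<open>A walk that crosses the new edge several times can be cut down to one that crosses it at
  most once, in one of the two directions.\<close>

lemma rtrancl_adjacency_insert: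
  "(a, b) \<in> (adjacency (insert {r, t} E))\<^sup>* \<longleftrightarrow> (a, b) \<in> (adjacency E)\<^sup>* \<or>
     (a, r) \<in> (adjacency E)\<^sup>* \<and> (t, b) \<in> (adjacency E)\<^sup>* \<or>
     (a, t) \<in> (adjacency E)\<^sup>* \<and> (r, b) \<in> (adjacency E)\<^sup>*"
  (is "?L \<longleftrightarrow> ?R")
proof
  assume ?L
  then show ?R
  proof (induction rule: rtrancl_induct)
    case base
    then show ?case by simp
  next
    case (step b c)
    then show ?case
      unfolding adjacency_insert by (auto intro: rtrancl_into_rtrancl rtrancl_trans)
  qed
next
  have *: "(adjacency E)\<^sup>* \<subseteq> (adjacency (insert {r, t} E))\<^sup>*"
    by (rule rtrancl_mono) (auto simp: adjacency_def)
  have **: "(r, t) \<in> (adjacency (insert {r, t} E))\<^sup>*" "(t, r) \<in> (adjacency (insert {r, t} E))\<^sup>*"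
    by (auto simp: adjacency_insert)
  assume ?R
  then show ?L
    using * ** by (meson rtrancl_trans subsetD)
qed

text \<open>Such a cycle must use the new edge, and the rest of it is a path in \<open>E\<close>
  between the two ends. Hence joining two different components creates no cycle.\<close>

lemma is_cycle_insert_connected:
  assumes cyc: "is_cycle (insert {r, t} E) vs" and ncyc: "\<not> is_cycle E vs"
  shows "(r, t) \<in> (adjacency E)\<^sup>*"
proof -
  define l where "l = length vs"
  have l: "3 \<le> l" and d: "distinct vs"
    and e: "\<And>i. i < l \<Longrightarrow> {vs ! i, vs ! (Suc i mod l)} \<in> insert {r, t} E"
    using cyc by (auto simp: is_cycle_def l_def)
  obtain i where i: "i < l" "{vs ! i, vs ! (Suc i mod l)} \<notin> E"
    using ncyc l d by (auto simp: is_cycle_def l_def)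
  have rt: "{vs ! i, vs ! (Suc i mod l)} = {r, t}" using e i by blast
  have eq: "vs ! a = vs ! b \<longleftrightarrow> a = b" if "a < l" "b < l" for a b
    using that d by (simp add: l_def nth_eq_iff_index_eq)
  \<comment> \<open>Walk around the cycle starting just after the step \<open>i\<close> that uses
    the new edge; fewer than \<open>l\<close> steps never repeat step \<open>i\<close>.\<close>
  have path: "(vs ! (Suc i mod l), vs ! ((Suc i + k) mod l)) \<in> (adjacency E)\<^sup>*" if "k < l" for k
    using that
  proof (induction k)
    case 0
    then show ?case by simp
  next
    case (Suc k)
    define j where "j = (Suc i + k) mod l"
    have jl: "j < l" using l by (simp add: j_def)
    have sj: "Suc j mod l = (Suc i + Suc k) mod l" by (simp add: j_def mod_simps)
    have ji: "j \<noteq> i"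
    proof
      assume "j = i"
      then have "(Suc i + k) mod l = i" by (simp add: j_def)
      then show False
        using Suc.prems i(1) by (cases "Suc i + k < l") (auto simp: le_mod_geq)
    qed
    \<comment> \<open>As the vertices are distinct, a second use of the edge would run it backwards,
      so two steps would close the cycle, against \<open>3 \<le> l\<close>.\<close>
    have "{vs ! j, vs ! (Suc j mod l)} \<noteq> {r, t}"
    proof
      assume "{vs ! j, vs ! (Suc j mod l)} = {r, t}"
      then have "{vs ! j, vs ! (Suc j mod l)} = {vs ! i, vs ! (Suc i mod l)}" using rt by simp
      then have "vs ! j = vs ! (Suc i mod l)" "vs ! (Suc j mod l) = vs ! i"
        using ji jl i eq by (auto simp: doubleton_eq_iff)
      then have "j = Suc i mod l" "Suc j mod l = i" using eq jl i l by auto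
      then show False using l i(1) by (auto simp: mod_Suc split: if_splits)
    qed
    then have "(vs ! j, vs ! (Suc j mod l)) \<in> adjacency E"
      using e[OF jl] by (simp add: adjacency_def)
    then show ?case using Suc sj by (auto simp: j_def intro: rtrancl_into_rtrancl)
  qed
  have "(Suc i + (l - 1)) mod l = i" using l i by simp
  then have "(vs ! (Suc i mod l), vs ! i) \<in> (adjacency E)\<^sup>*" using path[of "l - 1"] l by simp
  then show ?thesis using rt rtrancl_adjacency_sym by (auto simp: doubleton_eq_iff)
qed

lemma SF_root_unique:
  assumes "(E, \<rho>) \<in> SF n" "r \<in> \<rho>" "s \<in> \<rho>" "(r, s) \<in> (adjacency E)\<^sup>*"
  shows "r = s"
proof -
  have "r \<in> {1..n}" using assms by (auto simp: SF_def)
  then have "\<exists>!q. q \<in> \<rho> \<and> (r, q) \<in> (adjacency E)\<^sup>*" using assms by (auto simp: SF_def)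
  then show ?thesis using assms by blast
qed

lemma SF_join:
  assumes F: "(E, \<rho>) \<in> SF n" and r: "r \<in> \<rho>" and t: "t \<in> \<rho>" and rt: "r \<noteq> t"
  shows "(insert {r, t} E, \<rho> - {t}) \<in> SF n"
proof -
  let ?A = "(adjacency E)\<^sup>*"
  have sub: "E \<subseteq> {{a, b} | a b. a \<in> {1..n} \<and> b \<in> {1..n} \<and> a \<noteq> b}"
    and ac: "\<And>vs. \<not> is_cycle E vs" and \<rho>: "\<rho> \<subseteq> {1..n}"
    and ex: "\<And>v. v \<in> {1..n} \<Longrightarrow> \<exists>!q. q \<in> \<rho> \<and> (v, q) \<in> ?A"
    using F by (auto simp: SF_def)
  have nconn: "(r, t) \<notin> ?A" using SF_root_unique[OF F r t] rt by blast
  have "\<exists>!q. q \<in> \<rho> - {t} \<and> (v, q) \<in> (adjacency (insert {r, t} E))\<^sup>*" if v: "v \<in> {1..n}" for v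
  proof -
    obtain q where q: "q \<in> \<rho>" "(v, q) \<in> ?A" using ex[OF v] by blast
    have u: "q' = q" if "q' \<in> \<rho>" "(v, q') \<in> ?A" for q' using ex[OF v] q that by blast
    have ur: "q' = r" if "q' \<in> \<rho>" "(r, q') \<in> ?A" for q'
      using SF_root_unique[OF F r that] by simp
    have ut: "q' = t" if "q' \<in> \<rho>" "(t, q') \<in> ?A" for q'
      using SF_root_unique[OF F t that] by simp
    show ?thesis
    \<comment> \<open>The vertices whose root was \<open>t\<close> now have root \<open>r\<close>;
      all others keep theirs.\<close>
    proof (rule ex1I[where a = "if q = t then r else q"], goal_cases)
      case 1
      then show ?case using q r rt by (auto simp: rtrancl_adjacency_insert)
    next
      case (2 q')
      then show ?case using u ur ut u[OF t] u[OF r] by (auto simp: rtrancl_adjacency_insert)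
    qed
  qed
  moreover have "\<not> is_cycle (insert {r, t} E) vs" for vs
    using is_cycle_insert_connected ac nconn by blast
  moreover have "{r, t} \<in> {{a, b} | a b. a \<in> {1..n} \<and> b \<in> {1..n} \<and> a \<noteq> b}"
    using r t rt \<rho> by blast
  ultimately show ?thesis
    unfolding SF_def using sub \<rho> by (intro CollectI case_prodI conjI ballI) auto
qed

lemma SF_le_join:
  assumes "(E, \<rho>) \<in> SF n" "r \<in> \<rho>" "t \<in> \<rho>" "r \<noteq> t"
  shows "((E, \<rho>), (insert {r, t} E, \<rho> - {t})) \<in> SF_le n"
proof -
  have "((E, \<rho>), (insert {r, t} E, \<rho> - {t})) \<in> SF_cover n"
    using assms SF_join[OF assms] unfolding SF_cover_def by blast
  then show ?thesis using assms SF_join[OF assms] unfolding SF_le_def by blast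
qed

lemma SF_le_trans: "(F, G) \<in> SF_le n \<Longrightarrow> (G, H) \<in> SF_le n \<Longrightarrow> (F, H) \<in> SF_le n"
  unfolding SF_le_def by auto

text \<open>Covers only add edges, so an edge of \<open>F\<close> missing in \<open>G\<close> shows
  that \<open>F\<close> is not below \<open>G\<close>. Incomparability is proved this way.\<close>

lemma SF_le_edges: "(F, G) \<in> SF_le n \<Longrightarrow> fst F \<subseteq> fst G"
proof -
  have "fst F \<subseteq> fst G" if "(F, G) \<in> (SF_cover n)\<^sup>*"
    using that by (induction rule: rtrancl_induct) (auto simp: SF_cover_def)
  then show "(F, G) \<in> SF_le n \<Longrightarrow> fst F \<subseteq> fst G" by (simp add: SF_le_def)
qed

lemma SF_incomparable_bounded:
  assumes XY: "(X, Y) \<in> SF_le n" "X \<noteq> Y" and YV: "(Y, V) \<in> SF_le n" "Y \<noteq> V"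
  obtains Y' Z where "(X, Y') \<in> SF_le n" "(Y', Z) \<in> SF_le n" "(Y, Z) \<in> SF_le n"
    "(Y, Y') \<notin> SF_le n" "(Y', Y) \<notin> SF_le n"
proof -
  \<comment> \<open>\<open>W\<close> is the last element before \<open>Y\<close> on a chain from
    \<open>X\<close>.\<close>
  obtain W where XW: "(X, W) \<in> (SF_cover n)\<^sup>*" and WY: "(W, Y) \<in> SF_cover n"
    using XY by (auto simp: SF_le_def elim: rtranclE)
  obtain Q where YQ: "(Y, Q) \<in> SF_cover n"
    using YV by (auto simp: SF_le_def elim: converse_rtranclE)
  obtain E \<rho> r s where W: "W = (E, \<rho>)" and r: "r \<in> \<rho>" and s: "s \<in> \<rho>" and rs: "r \<noteq> s"
    and Y: "Y = (insert {r, s} E, \<rho> - {s})" and WSF: "(E, \<rho>) \<in> SF n" and YSF: "Y \<in> SF n"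
    using WY unfolding SF_cover_def by blast
  \<comment> \<open>The cover \<open>Q\<close> joins two distinct roots of \<open>Y\<close>, and at
    least one of them is not \<open>r\<close>.\<close>
  obtain t where t: "t \<in> \<rho>" "t \<noteq> s" "t \<noteq> r"
    using YQ Y unfolding SF_cover_def by blast
  have no_edge: "{a, b} \<notin> E" if "a \<in> \<rho>" "b \<in> \<rho>" "a \<noteq> b" for a b
    using SF_root_unique[OF WSF that(1,2)] that(3) by (auto simp: adjacency_def)
  let ?Y' = "(insert {r, t} E, \<rho> - {t})"
  let ?Z = "(insert {r, t} (insert {r, s} E), \<rho> - {s} - {t})"
  have XW': "(X, W) \<in> SF_le n" using XW XY(1) WSF W by (auto simp: SF_le_def)
  have "(X, ?Y') \<in> SF_le n"
    using SF_le_trans[OF XW'] SF_le_join[OF WSF r t(1)] t W by auto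
  moreover have "(Y, ?Z) \<in> SF_le n"
    using SF_le_join[of "insert {r, s} E" "\<rho> - {s}" n r t] YSF Y r rs t by auto
  moreover have "(?Y', ?Z) \<in> SF_le n"
  proof -
    \<comment> \<open>The two joins commute, so \<open>?Z\<close> also arises from
      \<open>?Y'\<close> by hanging \<open>s\<close> on \<open>r\<close>.\<close>
    have "?Z = (insert {r, s} (insert {r, t} E), \<rho> - {t} - {s})" by auto
    then show ?thesis
      using SF_le_join[of "insert {r, t} E" "\<rho> - {t}" n r s] SF_join[OF WSF r t(1)] r rs s t by auto
  qed
  moreover have "(Y, ?Y') \<notin> SF_le n"
  proof
    assume "(Y, ?Y') \<in> SF_le n"
    then have "{r, s} \<in> insert {r, t} E" using SF_le_edges Y by fastforce
    then show False using no_edge[OF r s rs] t by (auto simp: doubleton_eq_iff)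
  qed
  moreover have "(?Y', Y) \<notin> SF_le n"
  proof
    assume "(?Y', Y) \<in> SF_le n"
    then have "{r, t} \<in> insert {r, s} E" using SF_le_edges Y by fastforce
    then show False using no_edge[OF r t(1)] t by (auto simp: doubleton_eq_iff)
  qed
  ultimately show thesis using that by blast
qed

section \<open>Merging pointed Lyndon trees\<close>

lemma leaves_nonempty [simp]: "leaves T \<noteq> []"
  by (induction T) auto

lemma \<nu>_Leaf [simp]: "\<nu> (Leaf i) = i"
  by (simp add: \<nu>_def)

lemma \<nu>_Node [simp]: "\<nu> (Node c l r) = min (\<nu> l) (\<nu> r)"
  by (simp add: \<nu>_def Min_Un)

lemma \<nu>_in_leaves: "\<nu> T \<in> set (leaves T)"
  by (simp add: \<nu>_def)

lemma pointed_lyndon_Leaf [simp]: "pointed_lyndon (Leaf i)"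
  by (simp add: pointed_lyndon_def bicolored_def normalized_def)

text \<open>Turns the conditions on all \<open>internals\<close> into a recursion that checks only
  the root; \<open>\<nu> l \<le> \<nu> r\<close> is normalization there.\<close>

lemma pointed_lyndon_Node:
  "pointed_lyndon (Node c l r) \<longleftrightarrow> pointed_lyndon l \<and> pointed_lyndon r \<and>
     set (leaves l) \<inter> set (leaves r) = {} \<and> c \<in> {0, 1} \<and> \<nu> l \<le> \<nu> r \<and>
     (\<not> is_Leaf l \<longrightarrow> c \<le> color l \<and> (color l = 1 \<and> c = 1 \<longrightarrow> \<nu> r < \<nu> (right l)))"
  by (auto simp: pointed_lyndon_def bicolored_def normalized_def lyndon_def)

lemma merge_stop:
  "pointed_lyndon (Node u A B) \<Longrightarrow> merge u A B = Node u A B"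
  by (simp add: merge_def while_unfold[where s = "([], A)"])

text \<open>Merges are evaluated by unfolding the loop; for the trees considered below, at most one
  slide occurs.\<close>

lemma merge_slide_once:
  assumes "\<not> pointed_lyndon (Node u (Node c L R) B)" "pointed_lyndon (Node c (Node u L B) R)"
  shows "merge u (Node c L R) B = Node c (Node u L B) R"
  using assms
  by (simp add: merge_def while_unfold[where s = "([], Node c L R)"]
      while_unfold[where s = "([(c, R)], L)"])

lemma merge_Leaf:
  assumes "u \<in> {0, 1}" "pointed_lyndon T" "i < \<nu> T"
  shows "merge u (Leaf i) T = Node u (Leaf i) T"
proof (rule merge_stop)
  have "i \<notin> set (leaves T)" using assms(3) by (auto simp: \<nu>_def)
  then show "pointed_lyndon (Node u (Leaf i) T)" using assms by (auto simp: pointed_lyndon_Node)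
qed

text \<open>If the loop stops at once, the left child is the whole first tree. Otherwise one slide
  makes the new vertex the left child, and the loop ends there.\<close>

lemma merge_cherry_left_internal:
  assumes "u \<in> {0, 1}" and A: "pointed_lyndon (Node c (Leaf a) B)" and Y: "pointed_lyndon Y"
    and dis: "set (leaves (Node c (Leaf a) B)) \<inter> set (leaves Y) = {}" and "a < \<nu> Y"
  shows "\<not> is_Leaf (left (merge u (Node c (Leaf a) B) Y))"
proof (cases "pointed_lyndon (Node u (Node c (Leaf a) B) Y)")
  case True
  then show ?thesis by (simp add: merge_stop)
next
  case False
  have "\<nu> B \<noteq> \<nu> Y" using dis \<nu>_in_leaves[of B] \<nu>_in_leaves[of Y] by auto
  have B: "pointed_lyndon B" "a \<notin> set (leaves B)" "c \<in> {0, 1}" "a \<le> \<nu> B"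
    using A by (simp_all add: pointed_lyndon_Node)
  have dis': "a \<notin> set (leaves Y)" "set (leaves Y) \<inter> set (leaves B) = {}" using dis by auto
  \<comment> \<open>All other conditions hold, so the failure lies in the color or Lyndon condition
    at the root. Its negation gives the same condition with the two vertices exchanged.\<close>
  have "\<not> (u \<le> c \<and> (c = 1 \<and> u = 1 \<longrightarrow> \<nu> Y < \<nu> B))"
    using False A Y dis assms(1,5) B(4) by (simp add: pointed_lyndon_Node[of u]) arith
  then have "c \<le> u \<and> (u = 1 \<and> c = 1 \<longrightarrow> \<nu> B < \<nu> Y)"
    using \<open>\<nu> B \<noteq> \<nu> Y\<close> by (cases "u \<le> c") auto
  moreover have "pointed_lyndon (Node u (Leaf a) Y)"
    using assms(1,5) Y dis' by (simp add: pointed_lyndon_Node)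
  ultimately have "pointed_lyndon (Node c (Node u (Leaf a) Y) B)"
    using B dis' by (simp add: pointed_lyndon_Node[of c])
  then show ?thesis by (simp add: merge_slide_once[OF False])
qed

text \<open>A right comb works: all its left children are leaves, so no color or Lyndon condition
  arises. It supplies the tree on \<open>{3..n}\<close>, which keeps the number of trees at three
  for every \<open>n\<close>.\<close>

lemma pointed_lyndon_exists:
  "m \<le> n \<Longrightarrow> \<exists>T. pointed_lyndon T \<and> set (leaves T) = {m..n} \<and> \<nu> T = m"
proof (induction rule: inc_induct)
  case base
  show ?case by (rule exI[of _ "Leaf n"]) simp
next
  case (step m)
  then obtain T where T: "pointed_lyndon T" "set (leaves T) = {Suc m..n}" "\<nu> T = Suc m" by blast
  have "pointed_lyndon (Node 0 (Leaf m) T)" using T by (auto simp: pointed_lyndon_Node)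
  then show ?case using T step by (intro exI[of _ "Node 0 (Leaf m) T"]) auto
qed

section \<open>An interval in the poset of pointed Lyndon forests\<close>

lemma FLyn_coverI:
  assumes "F \<in> FLyn n" "F' \<in> FLyn n" "u \<in> {0, 1}" "A \<in> F" "B \<in> F" "\<nu> A < \<nu> B"
    "F' = insert (merge u A B) (F - {A, B})"
  shows "(F, F') \<in> FLyn_cover n"
  using assms unfolding FLyn_cover_def by blast

lemma FLyn_cover_pair:
  assumes "({A, B}, F) \<in> FLyn_cover n" "\<nu> A < \<nu> B"
  obtains u where "u \<in> {0, 1}" "F = {merge u A B}"
proof -
  obtain u T1 T2 where u: "u \<in> {0, 1}" and T: "T1 \<in> {A, B}" "T2 \<in> {A, B}" "\<nu> T1 < \<nu> T2"
    and F: "F = insert (merge u T1 T2) ({A, B} - {T1, T2})"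
    using assms(1) unfolding FLyn_cover_def by blast
  have "T1 = A" "T2 = B" using T assms(2) by auto
  then show thesis using that u F by auto
qed

lemma FLyn_no_cover_single: "({A}, F) \<notin> FLyn_cover n"
  by (auto simp: FLyn_cover_def)

lemma FLyn_above_single:
  assumes "({A}, F) \<in> (FLyn_cover n)\<^sup>*" shows "F = {A}"
  using assms by (cases rule: converse_rtranclE) (auto simp: FLyn_no_cover_single)

text \<open>Only one merge is left; the minimal leaves fix the order of its arguments, and only the
  color is free.\<close>

lemma FLyn_above_pair:
  assumes "({A, B}, F) \<in> (FLyn_cover n)\<^sup>*" "\<nu> A < \<nu> B"
  shows "F = {A, B} \<or> (\<exists>u \<in> {0, 1}. F = {merge u A B})"
  using assms(1)
proof (cases rule: converse_rtranclE)
  case (step G)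
  then show ?thesis using FLyn_cover_pair[OF step(1) assms(2)] FLyn_above_single by metis
qed simp

lemma FLyn_cover_triple:
  assumes "({A, B, C}, F) \<in> FLyn_cover n" "\<nu> A < \<nu> B" "\<nu> B < \<nu> C"
  obtains u where "u \<in> {0, 1}" "F = {merge u A B, C} \<or> F = {merge u A C, B} \<or> F = {A, merge u B C}"
proof -
  obtain u T1 T2 where u: "u \<in> {0, 1}"
    and T: "T1 \<in> {A, B, C}" "T2 \<in> {A, B, C}" "\<nu> T1 < \<nu> T2"
    and F: "F = insert (merge u T1 T2) ({A, B, C} - {T1, T2})"
    using assms(1) unfolding FLyn_cover_def by blast
  have "A \<noteq> B" "A \<noteq> C" "B \<noteq> C" using assms by auto
  moreover have "T1 = A \<and> T2 = B \<or> T1 = A \<and> T2 = C \<or> T1 = B \<and> T2 = C" using T assms by auto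
  ultimately have "F = {merge u A B, C} \<or> F = {merge u A C, B} \<or> F = {A, merge u B C}"
    using F by auto
  then show thesis using that u by blast
qed

lemma FLyn_le_refl: "F \<in> FLyn n \<Longrightarrow> (F, F) \<in> FLyn_le n"
  by (simp add: FLyn_le_def)

text \<open>As \<open>X\<close> has three trees, everything above it is reached by at most two
  merges and can be enumerated.\<close>

lemma FLyn_incomparable_unbounded:
  assumes n: "3 \<le> n"
  obtains X Y V where "(X, Y) \<in> FLyn_le n" "X \<noteq> Y" "(Y, V) \<in> FLyn_le n" "Y \<noteq> V"
    "\<nexists>Y' Z. (X, Y') \<in> FLyn_le n \<and> (Y', Z) \<in> FLyn_le n \<and> (Y, Z) \<in> FLyn_le n \<and>
      (Y, Y') \<notin> FLyn_le n \<and> (Y', Y) \<notin> FLyn_le n"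
proof -
  obtain T where T: "pointed_lyndon T" "set (leaves T) = {3..n}" "\<nu> T = 3"
    using pointed_lyndon_exists[OF n] by blast
  let ?D = "\<lambda>c. Node c (Leaf 2) T"
  let ?X = "{Leaf 1, Leaf 2, T}" and ?Y = "{Leaf 1, ?D 0}" and ?V = "{Node 0 (Leaf 1) (?D 0)}"
  have neq: "T \<noteq> Leaf 1" "T \<noteq> Leaf 2" using T(3) by auto
  have un: "{1..n} = insert 1 (insert 2 {3..n})" using n by auto
  have D: "pointed_lyndon (?D c)" if "c \<in> {0, 1}" for c
    using that T by (auto simp: pointed_lyndon_Node)
  have V: "pointed_lyndon (Node c (Leaf 1) (?D 0))" if "c \<in> {0, 1}" for c
    using that T D[of 0] by (auto simp: pointed_lyndon_Node)
  have XF: "?X \<in> FLyn n" using T un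
    by (auto simp: FLyn_def pairwise_insert disjnt_def)
  have YF: "?Y \<in> FLyn n" using T un D[of 0]
    by (auto simp: FLyn_def pairwise_insert disjnt_def)
  have VF: "?V \<in> FLyn n" using T un V[of 0]
    by (auto simp: FLyn_def pairwise_insert disjnt_def)
  have mD: "merge c (Leaf 2) T = ?D c" if "c \<in> {0, 1}" for c
    using merge_Leaf[OF that T(1)] T(3) by simp
  have mV: "merge u (Leaf 1) (?D c) = Node u (Leaf 1) (?D c)" if "u \<in> {0, 1}" "c \<in> {0, 1}" for u c
    using merge_Leaf[OF that(1) D[OF that(2)]] T(3) by simp
  have "(?X, ?Y) \<in> FLyn_cover n"
  proof -
    have "?Y = insert (merge 0 (Leaf 2) T) (?X - {Leaf 2, T})" using mD[of 0] neq by auto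
    then show ?thesis using FLyn_coverI[OF XF YF, of 0 "Leaf 2" T] T(3) by simp
  qed
  then have XY: "(?X, ?Y) \<in> FLyn_le n" using XF YF by (auto simp: FLyn_le_def)
  have "(?Y, ?V) \<in> FLyn_cover n"
  proof -
    have "?V = insert (merge 0 (Leaf 1) (?D 0)) (?Y - {Leaf 1, ?D 0})" using mV[of 0 0] by auto
    then show ?thesis using FLyn_coverI[OF YF VF, of 0 "Leaf 1" "?D 0"] T(3) by simp
  qed
  then have YV: "(?Y, ?V) \<in> FLyn_le n" using YF VF by (auto simp: FLyn_le_def)
  have False if a: "(?X, Y') \<in> FLyn_le n" "(Y', Z) \<in> FLyn_le n" "(?Y, Z) \<in> FLyn_le n"
      "(?Y, Y') \<notin> FLyn_le n" "(Y', ?Y) \<notin> FLyn_le n" for Y' Z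
  proof -
    have Y'F: "Y' \<in> FLyn n" using a by (simp add: FLyn_le_def)
    \<comment> \<open>Otherwise \<open>Y'\<close> would lie below \<open>?Y\<close>. So
      \<open>Z\<close> is a single tree with a leaf as left child.\<close>
    have "Z \<noteq> ?Y" using a by auto
    moreover have "Z = ?Y \<or> (\<exists>u \<in> {0, 1}. Z = {merge u (Leaf 1) (?D 0)})"
      by (rule FLyn_above_pair) (use a T in \<open>auto simp: FLyn_le_def\<close>)
    ultimately obtain u where u: "u \<in> {0, 1}" and Z: "Z = {Node u (Leaf 1) (?D 0)}"
      using mV by auto
    have "Y' \<noteq> ?X" using a XY by auto
    then obtain W where XW: "(?X, W) \<in> FLyn_cover n" and WY': "(W, Y') \<in> (FLyn_cover n)\<^sup>*"
      using a(1) by (auto simp: FLyn_le_def elim: converse_rtranclE)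
    have "\<nu> (Leaf 1) < \<nu> (Leaf 2)" "\<nu> (Leaf 2) < \<nu> T" using T by simp_all
    then obtain c where c: "c \<in> {0, 1}" and W3: "W = {merge c (Leaf 1) (Leaf 2), T} \<or>
        W = {merge c (Leaf 1) T, Leaf 2} \<or> W = {Leaf 1, merge c (Leaf 2) T}"
      using FLyn_cover_triple[OF XW] by blast
    have m: "merge c (Leaf 1) (Leaf 2) = Node c (Leaf 1) (Leaf 2)"
      "merge c (Leaf 1) T = Node c (Leaf 1) T"
      using merge_Leaf[OF c] T by simp_all
    \<comment> \<open>The three possible first merges, with the two resulting trees ordered by
      minimal leaf.\<close>
    obtain A B where W: "W = {A, B}" "\<nu> A < \<nu> B"
      and AB: "A = Node c (Leaf 1) (Leaf 2) \<and> B = T \<or> A = Node c (Leaf 1) T \<and> B = Leaf 2 \<or>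
        A = Leaf 1 \<and> B = ?D c"
    proof -
      consider "W = {Node c (Leaf 1) (Leaf 2), T}" | "W = {Node c (Leaf 1) T, Leaf 2}"
        | "W = {Leaf 1, ?D c}"
        using W3 m mD[OF c] by auto
      then show thesis using that T(3) by cases auto
    qed
    have Y'Z: "Y' \<noteq> Z" using a by auto
    \<comment> \<open>Above \<open>W\<close> there are only single trees, which are maximal; such a
      \<open>Y'\<close> would equal \<open>Z\<close> and so lie above \<open>?Y\<close>.\<close>
    have "Y' = W"
    proof (rule ccontr)
      assume "Y' \<noteq> W"
      then obtain v where "Y' = {merge v A B}" using FLyn_above_pair WY' W by blast
      then show False using FLyn_above_single[of _ Z n] a(2) Y'Z by (auto simp: FLyn_le_def)
    qed
    then obtain v where v: "v \<in> {0, 1}" and Zm: "Z = {merge v A B}"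
      using FLyn_above_pair[of A B Z n] W a(2) Y'Z by (auto simp: FLyn_le_def)
    have pl: "pointed_lyndon A" "pointed_lyndon B"
      using Y'F \<open>Y' = W\<close> W(1) by (auto simp: FLyn_def)
    have "set (leaves A) \<inter> set (leaves B) = {}"
      using Y'F \<open>Y' = W\<close> W by (auto simp: FLyn_def pairwise_insert disjnt_def)
    then have "\<not> is_Leaf (left (merge v A B))" if "A = Node c (Leaf 1) S" for S
      using merge_cherry_left_internal[OF v, of c 1 S B] pl W(2) AB T(3) that by auto
    \<comment> \<open>In the other two cases the left child in \<open>Z\<close> would be internal.
      What remains is \<open>?Y\<close> up to the color \<open>c\<close>, and the right child of the
      tree in \<open>Z\<close> forces \<open>c = 0\<close>.\<close>
    then have "A = Leaf 1" "B = ?D c" using AB Z Zm by auto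
    then have "c = 0" using Zm Z mV[OF v c] by simp
    then have "Y' = ?Y" using \<open>Y' = W\<close> W \<open>A = Leaf 1\<close> \<open>B = ?D c\<close> by simp
    then show False using a(4) FLyn_le_refl[OF YF] by simp
  qed
  then have no: "\<nexists>Y' Z. (?X, Y') \<in> FLyn_le n \<and> (Y', Z) \<in> FLyn_le n \<and> (?Y, Z) \<in> FLyn_le n \<and>
      (?Y, Y') \<notin> FLyn_le n \<and> (Y', ?Y) \<notin> FLyn_le n"
    by meson
  have XneqY: "?X \<noteq> ?Y"
  proof -
    have "Leaf 2 \<in> ?X" "Leaf 2 \<notin> ?Y" by simp_all
    then show ?thesis by metis
  qed
  have YneqV: "?Y \<noteq> ?V"
  proof -
    have "Leaf 1 \<in> ?Y" "Leaf 1 \<notin> ?V" by simp_all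
    then show ?thesis by metis
  qed
  show thesis by (rule that[OF XY XneqY YV YneqV no])
qed

section \<open>Transport along an isomorphism\<close>

theorem theorem5p5:
  fixes n :: nat
  assumes "n \<ge> 3"
  shows "\<not> (\<exists>f. bij_betw f (FLyn n) (SF n) \<and>
    (\<forall>F \<in> FLyn n. \<forall>F' \<in> FLyn n. (F, F') \<in> FLyn_le n \<longleftrightarrow> (f F, f F') \<in> SF_le n))"
proof
  assume "\<exists>f. bij_betw f (FLyn n) (SF n) \<and>
    (\<forall>F \<in> FLyn n. \<forall>F' \<in> FLyn n. (F, F') \<in> FLyn_le n \<longleftrightarrow> (f F, f F') \<in> SF_le n)"
  then obtain f where bij: "bij_betw f (FLyn n) (SF n)"
    and iso: "\<And>F F'. F \<in> FLyn n \<Longrightarrow> F' \<in> FLyn n \<Longrightarrow>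
      (F, F') \<in> FLyn_le n \<longleftrightarrow> (f F, f F') \<in> SF_le n"
    by blast
  obtain X Y V where XY: "(X, Y) \<in> FLyn_le n" "X \<noteq> Y" and YV: "(Y, V) \<in> FLyn_le n" "Y \<noteq> V"
    and no: "\<nexists>Y' Z. (X, Y') \<in> FLyn_le n \<and> (Y', Z) \<in> FLyn_le n \<and> (Y, Z) \<in> FLyn_le n \<and>
      (Y, Y') \<notin> FLyn_le n \<and> (Y', Y) \<notin> FLyn_le n"
    by (rule FLyn_incomparable_unbounded[OF assms])
  have mem: "X \<in> FLyn n" "Y \<in> FLyn n" "V \<in> FLyn n" using XY YV by (auto simp: FLyn_le_def)
  then have "f X \<noteq> f Y" "f Y \<noteq> f V"
    using XY YV bij by (auto simp: bij_betw_def inj_on_eq_iff)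
  \<comment> \<open>The property that separates the posets is expressed by the order alone, so
    \<open>f\<close> carries the chain to \<open>SF n\<close>, and surjectivity brings the witnesses
    back.\<close>
  then obtain Y' Z where YZ: "(f X, Y') \<in> SF_le n" "(Y', Z) \<in> SF_le n" "(f Y, Z) \<in> SF_le n"
    "(f Y, Y') \<notin> SF_le n" "(Y', f Y) \<notin> SF_le n"
    using SF_incomparable_bounded XY YV iso mem by metis
  then have "Y' \<in> SF n" "Z \<in> SF n" by (auto simp: SF_le_def)
  then obtain y' z where "y' \<in> FLyn n" "z \<in> FLyn n" "Y' = f y'" "Z = f z"
    using bij unfolding bij_betw_def by blast
  then show False using no YZ iso mem by metis
qed

end
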